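(* Let $\mathcal{X}\subseteq\mathbb{R}^d$ be compact and let $h:\mathcal{X}\times\mathcal{X}\to\mathbb{R}_+$ be a continuous, symmetric, positive definite kernel. Define $\Phi(\mu)=\iint h(x,y)\,d\mu(x)\,d\mu(y)$ for $\mu\in\mathcal{P}(\mathcal{X})$. Let $(X_t)_{t\ge1}$ be i.i.d. from some $P\in\mathcal{P}(\mathcal{X})$, with empirical measure $P_t=\frac1t\sum_{i=1}^t\delta_{X_i}$, and let $V_t=\Phi(P_t)=\frac1{t^2}\sum_{i,j=1}^th(X_i,X_j)$. Then $\mu\mapsto\sqrt{\Phi(\mu)}$ is a convex functional on $\mathcal{P}(\mathcal{X})$, and thus $(\sqrt{V_t})_{t\ge1}$ and $(V_t)_{t\ge1}$ are reverse submartingales with respect to the exchangeable filtration $(\mathcal{E}^X_t)_{t\ge 1}$.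
   Context: $\mathcal{P}(\mathcal{X})$ is the set of Borel probability measures on $\mathcal{X}$. Positive definite kernel: for all finite sets of points $x_1,\dots,x_n\in\mathcal{X}$ the matrix $(h(x_i,x_j))_{i,j}$ is positive semidefinite. A functional $\Theta$ on $\mathcal{P}(\mathcal{X})$ is convex if $\Theta(\lambda\mu_1+(1-\lambda)\mu_2)\le\lambda\Theta(\mu_1)+(1-\lambda)\Theta(\mu_2)$ for all $\lambda\in[0,1]$, $\mu_1,\mu_2\in\mathcal{P}(\mathcal{X})$. $\mathcal{E}^X_t$ is the $\sigma$-algebra generated by all real-valued Borel-measurable functions of $X_1,X_2,\dots$ which are permutation-symmetric in their first $t$ arguments. A reverse submartingale with respect to a nonincreasing sequence of $\sigma$-algebras $(\mathcal{F}_t)$ is an integrable process with $R_t$ $\mathcal{F}_t$-measurable and $\mathbb{E}[R_t\mid\mathcal{F}_{t+1}]\ge R_{t+1}$ a.s. for all $t\ge1$. *)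

theory Defs
  imports "HOL-Probability.Probability" "HOL-Combinatorics.Permutations"
begin

abbreviation borel_on :: "'a::topological_space set \<Rightarrow> 'a measure" where
  "borel_on S \<equiv> restrict_space borel S"

abbreviation prob_measures :: "'a::topological_space set \<Rightarrow> 'a measure set" where
  "prob_measures S \<equiv> space (prob_algebra (borel_on S))"

definition psd_matrix :: "nat \<Rightarrow> (nat \<Rightarrow> nat \<Rightarrow> real) \<Rightarrow> bool" where
  "psd_matrix n A \<longleftrightarrow>
     (\<forall>i<n. \<forall>j<n. A i j = A j i) \<and>
     (\<forall>c :: nat \<Rightarrow> real. 0 \<le> (\<Sum>i<n. \<Sum>j<n. c i * A i j * c j))"

definition positive_definite_kernel :: "'a set \<Rightarrow> ('a \<Rightarrow> 'a \<Rightarrow> real) \<Rightarrow> bool" where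
  "positive_definite_kernel S h \<longleftrightarrow>
     (\<forall>n. \<forall>x :: nat \<Rightarrow> 'a. (\<forall>i<n. x i \<in> S) \<longrightarrow> psd_matrix n (\<lambda>i j. h (x i) (x j)))"

definition Phi :: "('a \<Rightarrow> 'a \<Rightarrow> real) \<Rightarrow> 'a measure \<Rightarrow> real" where
  "Phi h \<mu> = (\<integral>x. (\<integral>y. h x y \<partial>\<mu>) \<partial>\<mu>)"

text \<open>The mixture \<open>c \<mu> + (1 - c) \<nu>\<close> of two measures on the same \<open>\<sigma>\<close>-algebra. That the set
  functions passed to \<^const>\<open>measure_of\<close> here and below are indeed measures is confirmed by the
  lemmas on \<^const>\<open>emeasure\<close> that follow the definitions.\<close>

definition mixture :: "real \<Rightarrow> 'a measure \<Rightarrow> 'a measure \<Rightarrow> 'a measure" where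
  "mixture c \<mu> \<nu> = measure_of (space \<mu>) (sets \<mu>)
     (\<lambda>A. ennreal c * emeasure \<mu> A + ennreal (1 - c) * emeasure \<nu> A)"

lemma space_mixture [simp]: "space (mixture c \<mu> \<nu>) = space \<mu>"
  and sets_mixture [simp]: "sets (mixture c \<mu> \<nu>) = sets \<mu>"
  by (simp_all add: mixture_def)

lemma emeasure_mixture:
  assumes "sets \<mu> = sets \<nu>" "A \<in> sets \<mu>"
  shows "emeasure (mixture c \<mu> \<nu>) A = ennreal c * emeasure \<mu> A + ennreal (1 - c) * emeasure \<nu> A"
proof (rule emeasure_measure_of[OF mixture_def])
  show "countably_additive (sets (mixture c \<mu> \<nu>))
     (\<lambda>A. ennreal c * emeasure \<mu> A + ennreal (1 - c) * emeasure \<nu> A)"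
  proof (rule countably_additiveI)
    fix B :: "nat \<Rightarrow> 'a set"
    assume B: "range B \<subseteq> sets (mixture c \<mu> \<nu>)" "disjoint_family B"
    have "(\<Sum>i. ennreal c * emeasure \<mu> (B i) + ennreal (1 - c) * emeasure \<nu> (B i)) =
      ennreal c * (\<Sum>i. emeasure \<mu> (B i)) + ennreal (1 - c) * (\<Sum>i. emeasure \<nu> (B i))"
      by (simp add: suminf_add[symmetric])
    also have "\<dots> = ennreal c * emeasure \<mu> (\<Union>i. B i) + ennreal (1 - c) * emeasure \<nu> (\<Union>i. B i)"
      using B assms(1) by (simp add: suminf_emeasure)
    finally show "(\<Sum>i. ennreal c * emeasure \<mu> (B i) + ennreal (1 - c) * emeasure \<nu> (B i)) =
      ennreal c * emeasure \<mu> (\<Union>i. B i) + ennreal (1 - c) * emeasure \<nu> (\<Union>i. B i)" .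
  qed
qed (use assms sets.space_closed in \<open>auto simp: positive_def\<close>)

definition convex_functional :: "'a::topological_space set \<Rightarrow> ('a measure \<Rightarrow> real) \<Rightarrow> bool" where
  "convex_functional S \<Theta> \<longleftrightarrow>
     (\<forall>c\<in>{0..1}. \<forall>\<mu>\<in>prob_measures S. \<forall>\<nu>\<in>prob_measures S.
        \<Theta> (mixture c \<mu> \<nu>) \<le> c * \<Theta> \<mu> + (1 - c) * \<Theta> \<nu>)"

definition empirical_measure ::
    "'a::topological_space set \<Rightarrow> (nat \<Rightarrow> 'w \<Rightarrow> 'a) \<Rightarrow> nat \<Rightarrow> 'w \<Rightarrow> 'a measure" where
  "empirical_measure S X t \<omega> = measure_of S (sets (borel_on S))
     (\<lambda>A. (\<Sum>i=1..t. emeasure (return (borel_on S) (X i \<omega>)) A) / of_nat t)"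

lemma space_empirical_measure [simp]: "space (empirical_measure S X t \<omega>) = S"
  and sets_empirical_measure [simp]: "sets (empirical_measure S X t \<omega>) = sets (borel_on S)"
proof -
  have S: "S = space (borel_on S)" by (simp add: space_restrict_space)
  show "space (empirical_measure S X t \<omega>) = S"
    unfolding empirical_measure_def
    by (subst (1 3) S) (simp add: space_measure_of_conv)
  show "sets (empirical_measure S X t \<omega>) = sets (borel_on S)"
    unfolding empirical_measure_def
    by (subst (1) S) (rule sets.sets_measure_of_eq)
qed

lemma emeasure_empirical_measure:
  assumes "A \<in> sets (borel_on S)"
  shows "emeasure (empirical_measure S X t \<omega>) A =
    (\<Sum>i=1..t. emeasure (return (borel_on S) (X i \<omega>)) A) / of_nat t"
proof (rule emeasure_measure_of[OF empirical_measure_def])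
  show "sets (borel_on S) \<subseteq> Pow S"
    using sets.space_closed[of "borel_on S"] by (simp add: space_restrict_space)
  show "countably_additive (sets (empirical_measure S X t \<omega>))
     (\<lambda>A. (\<Sum>i=1..t. emeasure (return (borel_on S) (X i \<omega>)) A) / of_nat t)"
  proof (rule countably_additiveI)
    fix B :: "nat \<Rightarrow> 'a set"
    assume B: "range B \<subseteq> sets (empirical_measure S X t \<omega>)" "disjoint_family B"
    have "(\<Sum>k. (\<Sum>i=1..t. emeasure (return (borel_on S) (X i \<omega>)) (B k)) / of_nat t) =
      (\<Sum>i=1..t. \<Sum>k. emeasure (return (borel_on S) (X i \<omega>)) (B k)) / of_nat t"
      by (simp add: divide_ennreal_def suminf_sum)
    also have "\<dots> = (\<Sum>i=1..t. emeasure (return (borel_on S) (X i \<omega>)) (\<Union>k. B k)) / of_nat t"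
      using B by (simp add: suminf_emeasure del: emeasure_return)
    finally show "(\<Sum>k. (\<Sum>i=1..t. emeasure (return (borel_on S) (X i \<omega>)) (B k)) / of_nat t) =
      (\<Sum>i=1..t. emeasure (return (borel_on S) (X i \<omega>)) (\<Union>k. B k)) / of_nat t" .
  qed
qed (use assms in \<open>auto simp: positive_def\<close>)

definition V_stat ::
    "'a::topological_space set \<Rightarrow> ('a \<Rightarrow> 'a \<Rightarrow> real) \<Rightarrow> (nat \<Rightarrow> 'w \<Rightarrow> 'a) \<Rightarrow> nat \<Rightarrow> 'w \<Rightarrow> real" where
  "V_stat S h X t \<omega> = Phi h (empirical_measure S X t \<omega>)"

text \<open>Sequences are indexed from 1, so they live in the product space over \<open>{1..}\<close>.\<close>

definition symmetric_in_first ::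
    "'a::topological_space set \<Rightarrow> nat \<Rightarrow> ((nat \<Rightarrow> 'a) \<Rightarrow> real) \<Rightarrow> bool" where
  "symmetric_in_first S t f \<longleftrightarrow>
     (\<forall>x\<in>space (Pi\<^sub>M {1..} (\<lambda>_. borel_on S)). \<forall>p. p permutes {1..t} \<longrightarrow> f (\<lambda>i. x (p i)) = f x)"

definition exchangeable_filtration ::
    "'w measure \<Rightarrow> 'a::topological_space set \<Rightarrow> (nat \<Rightarrow> 'w \<Rightarrow> 'a) \<Rightarrow> nat \<Rightarrow> 'w measure" where
  "exchangeable_filtration M S X t = sigma (space M)
     {(\<lambda>\<omega>. f (\<lambda>i\<in>{1..}. X i \<omega>)) -` B \<inter> space M | f B.
        f \<in> borel_measurable (Pi\<^sub>M {1..} (\<lambda>_. borel_on S)) \<and> symmetric_in_first S t f \<and> B \<in> sets borel}"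

definition reverse_submartingale ::
    "'w measure \<Rightarrow> (nat \<Rightarrow> 'w measure) \<Rightarrow> (nat \<Rightarrow> 'w \<Rightarrow> real) \<Rightarrow> bool" where
  "reverse_submartingale M F R \<longleftrightarrow>
     (\<forall>t\<ge>1. subalgebra M (F t)) \<and>
     (\<forall>t\<ge>1. sets (F (t + 1)) \<subseteq> sets (F t)) \<and>
     (\<forall>t\<ge>1. integrable M (R t)) \<and>
     (\<forall>t\<ge>1. R t \<in> borel_measurable (F t)) \<and>
     (\<forall>t\<ge>1. AE \<omega> in M. real_cond_exp M (F (t + 1)) (R t) \<omega> \<ge> R (t + 1) \<omega>)"

end

theory Submission
  imports Defs
begin

text \<open>For \<open>n\<close> independent samples \<open>z\<^sub>1, \<dots>, z\<^sub>n\<close> of a pair \<open>(x, y)\<close> distributed as \<open>\<mu> \<otimes> \<nu>\<close>,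
  positive definiteness applied to the points \<open>x\<^sub>i\<close> with weight \<open>a\<close> and \<open>y\<^sub>i\<close> with weight \<open>b\<close> gives
  in the limit \<open>n \<rightarrow> \<infinity>\<close> that \<open>a\<^sup>2 \<Phi>(\<mu>) + 2 a b \<integral>\<integral> h d\<mu> d\<nu> + b\<^sup>2 \<Phi>(\<nu>) \<ge> 0\<close>. So \<open>\<surd>\<Phi>\<close> satisfies the
  Cauchy-Schwarz inequality, hence is convex. The empirical measure \<open>P\<^bsub>t+1\<^esub>\<close> is the average of the
  \<open>t + 1\<close> empirical measures that leave one point out. By exchangeability the conditional expectation
  of \<open>\<surd>V\<^sub>t\<close> given \<open>\<E>\<^bsub>t+1\<^esub>\<close> is the average of \<open>\<surd>\<Phi>\<close> over them, which is at least \<open>\<surd>V\<^bsub>t+1\<^esub>\<close> by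
  convexity. For \<open>V\<^sub>t\<close> itself, square this inequality and use the convexity of the square.\<close>

subsection \<open>Convexity of the root of the energy\<close>

lemma distr_PiM_pair:
  assumes "prob_space N" "i \<in> I" "j \<in> I" "i \<noteq> j"
  shows "distr (Pi\<^sub>M I (\<lambda>_. N)) (N \<Otimes>\<^sub>M N) (\<lambda>z. (z i, z j)) = N \<Otimes>\<^sub>M N"
proof -
  interpret N: prob_space N by fact
  interpret product_prob_space "\<lambda>_. N" I ..
  have [measurable]: "(\<lambda>z. z i) \<in> measurable (Pi\<^sub>M I (\<lambda>_. N)) N"
      "(\<lambda>z. z j) \<in> measurable (Pi\<^sub>M I (\<lambda>_. N)) N"
    using assms by (auto intro: measurable_component_singleton)
  show ?thesis
  proof (rule pair_measure_eqI[symmetric])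
    fix A B assume AB: "A \<in> sets N" "B \<in> sets N"
    \<comment> \<open>Because \<open>i\<close> and \<open>j\<close> differ, the rectangle becomes
      one condition per coordinate, with \<open>?E\<close> picking the factor.\<close>
    let ?E = "\<lambda>k. if k = i then A else B"
    have "emeasure (distr (Pi\<^sub>M I (\<lambda>_. N)) (N \<Otimes>\<^sub>M N) (\<lambda>z. (z i, z j))) (A \<times> B) =
        emeasure (Pi\<^sub>M I (\<lambda>_. N)) {z \<in> space (Pi\<^sub>M I (\<lambda>_. N)). \<forall>k\<in>{i, j}. z k \<in> ?E k}"
      using AB assms(4) by (subst emeasure_distr) (auto intro!: arg_cong2[where f=emeasure])
    also have "\<dots> = (\<Prod>k\<in>{i, j}. emeasure N (?E k))"
      using AB assms(2,3) by (intro emeasure_PiM_Collect) auto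
    also have "\<dots> = emeasure N A * emeasure N B"
      using assms(4) by simp
    finally show "emeasure N A * emeasure N B =
        emeasure (distr (Pi\<^sub>M I (\<lambda>_. N)) (N \<Otimes>\<^sub>M N) (\<lambda>z. (z i, z j))) (A \<times> B)" ..
  qed (simp_all add: N.sigma_finite_measure_axioms)
qed

text \<open>For \<open>n\<close> independent samples from \<open>N\<close> the double sum has expectation
  \<open>n D + n (n - 1) J\<close> with \<open>J\<close> the double integral and \<open>D\<close> the integral over the diagonal.\<close>

lemma double_integral_nonneg_if_sums_nonneg:
  fixes K :: "'a \<Rightarrow> 'a \<Rightarrow> real"
  assumes "prob_space N" and K[measurable]: "case_prod K \<in> borel_measurable (N \<Otimes>\<^sub>M N)"
    and bound: "\<And>x y. x \<in> space N \<Longrightarrow> y \<in> space N \<Longrightarrow> \<bar>K x y\<bar> \<le> C"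
    and pos: "\<And>n z. (\<And>i::nat. i < n \<Longrightarrow> z i \<in> space N) \<Longrightarrow> 0 \<le> (\<Sum>i<n. \<Sum>j<n. K (z i) (z j))"
  shows "0 \<le> (\<integral>x. (\<integral>y. K x y \<partial>N) \<partial>N)"
proof (rule ccontr)
  define J where "J = (\<integral>x. (\<integral>y. K x y \<partial>N) \<partial>N)"
  define D where "D = (\<integral>x. K x x \<partial>N)"
  assume "\<not> 0 \<le> (\<integral>x. (\<integral>y. K x y \<partial>N) \<partial>N)"
  then have neg: "0 < - J" by (simp add: J_def)
  interpret N: prob_space N by fact
  interpret NN: pair_prob_space N N ..
  have J: "(\<integral>z. case_prod K z \<partial>(N \<Otimes>\<^sub>M N)) = J"
    unfolding J_def using bound
    by (subst NN.integral_fst'[symmetric])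
       (auto intro!: NN.P.integrable_const_bound[where B=C] simp: space_pair_measure)
  have main: "0 \<le> real n * (D + (real n - 1) * J)" for n
  proof -
    let ?P = "Pi\<^sub>M {..<n} (\<lambda>_. N)"
    interpret P: prob_space ?P by (intro prob_space_PiM N.prob_space_axioms)
    have comp [measurable]: "(\<lambda>z. z i) \<in> measurable ?P N" if "i < n" for i
      using that by (auto intro: measurable_component_singleton)
    have sp: "z i \<in> space N" if "z \<in> space ?P" "i < n" for z i
      using that by (auto simp: space_PiM)
    have int: "integrable ?P (\<lambda>z. K (z i) (z j))" if "i < n" "j < n" for i j
    proof (rule P.integrable_const_bound[where B=C])
      show "AE z in ?P. norm (K (z i) (z j)) \<le> C"
        using that sp bound by (intro AE_I2) auto
      have "(\<lambda>z. case_prod K (z i, z j)) \<in> borel_measurable ?P"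
        using that by measurable
      then show "(\<lambda>z. K (z i) (z j)) \<in> borel_measurable ?P" by simp
    qed
    have E: "(\<integral>z. K (z i) (z j) \<partial>?P) = (if i = j then D else J)" if "i < n" "j < n" for i j
    proof (cases "i = j")
      case True
      have "D = (\<integral>x. K x x \<partial>distr ?P N (\<lambda>z. z i))"
        unfolding D_def using that by (subst distr_PiM_component) (auto simp: N.prob_space_axioms)
      also have "\<dots> = (\<integral>z. K (z i) (z i) \<partial>?P)"
      proof (rule integral_distr)
        have "(\<lambda>x. case_prod K (x, x)) \<in> borel_measurable N" by measurable
        then show "(\<lambda>x. K x x) \<in> borel_measurable N" by simp
      qed (use that in measurable)
      finally show ?thesis using True by simp
    next
      case False
      have "J = (\<integral>x. case_prod K x \<partial>distr ?P (N \<Otimes>\<^sub>M N) (\<lambda>z. (z i, z j)))"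
        using that False by (subst distr_PiM_pair) (auto simp: N.prob_space_axioms J)
      also have "\<dots> = (\<integral>z. case_prod K (z i, z j) \<partial>?P)"
        using that by (intro integral_distr) measurable
      finally show ?thesis using False by simp
    qed
    have "0 \<le> (\<integral>z. (\<Sum>i<n. \<Sum>j<n. K (z i) (z j)) \<partial>?P)"
      using sp by (intro Bochner_Integration.integral_nonneg pos) auto
    also have "\<dots> = (\<Sum>i<n. \<integral>z. (\<Sum>j<n. K (z i) (z j)) \<partial>?P)"
      by (intro Bochner_Integration.integral_sum Bochner_Integration.integrable_sum int) auto
    also have "\<dots> = (\<Sum>i<n. \<Sum>j<n. \<integral>z. K (z i) (z j) \<partial>?P)"
      by (intro sum.cong refl Bochner_Integration.integral_sum int) auto
    also have "\<dots> = (\<Sum>i<n. \<Sum>j<n. if i = j then D else J)"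
      by (intro sum.cong refl E) auto
    \<comment> \<open>Splitting off the constant \<open>J\<close> leaves a diagonal delta, so the
      sum is \<open>n * (D - J) + n * n * J\<close>.\<close>
    also have "\<dots> = (\<Sum>i<n. \<Sum>j<n. (if i = j then D - J else 0) + J)"
      by (intro sum.cong) auto
    also have "\<dots> = real n * (D + (real n - 1) * J)"
      by (simp add: sum.distrib algebra_simps)
    finally show ?thesis .
  qed
  \<comment> \<open>A negative \<open>J\<close> outweighs the diagonal for large samples: with
    \<open>Suc n\<close> points the bracket in \<open>main\<close> is \<open>D + n * J\<close>,
    which this \<open>n\<close> makes negative.\<close>
  obtain n :: nat where n: "\<bar>D\<bar> < real n * (- J)"
    using neg ex_less_of_nat_mult by blast
  have "real (Suc n) * (D + real n * J) < 0"
    using n by (intro mult_pos_neg) auto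
  with main[of "Suc n"] show False by simp
qed

text \<open>The discriminant criterion for a nonnegative binary quadratic form; the degenerate case
  \<open>A = 0\<close> is treated apart.\<close>

lemma cauchy_schwarz_of_nonneg_form:
  fixes A B C :: real
  assumes "\<And>a b. 0 \<le> a\<^sup>2 * A + 2 * a * b * B + b\<^sup>2 * C"
  shows "B \<le> sqrt A * sqrt C"
proof -
  have A: "0 \<le> A" using assms[of 1 0] by simp
  have "B\<^sup>2 \<le> A * C"
  proof (cases "A = 0")
    case True
    have "B = 0"
    proof (rule ccontr)
      assume "B \<noteq> 0"
      \<comment> \<open>At \<open>b = 1\<close> the form is affine in \<open>a\<close>, and this
        \<open>a\<close> gives it the value -1.\<close>
      with assms[of "- (C + 1) / (2 * B)" 1] True show False by (simp add: field_simps)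
    qed
    with True show ?thesis by simp
  next
    case False
    \<comment> \<open>The minimizing ratio \<open>a / b = - B / A\<close>, cleared of its
      denominator.\<close>
    have "0 \<le> A * (A * C - B\<^sup>2)"
      using assms[of "- B" A] by (simp add: power2_eq_square algebra_simps)
    with False A show ?thesis by (simp add: zero_le_mult_iff)
  qed
  then have "\<bar>B\<bar> \<le> sqrt (A * C)" using real_le_rsqrt[of "\<bar>B\<bar>" "A * C"] by simp
  then show ?thesis by (simp add: real_sqrt_mult)
qed

section \<open>Integrals over marginals of a product and over mixtures\<close>

lemma integral_pair_fst:
  fixes f :: "'a \<Rightarrow> real"
  assumes "prob_space \<nu>" and [measurable]: "f \<in> borel_measurable \<mu>"
  shows "(\<integral>z. f (fst z) \<partial>(\<mu> \<Otimes>\<^sub>M \<nu>)) = (\<integral>x. f x \<partial>\<mu>)"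
proof -
  have "(\<integral>x. f x \<partial>\<mu>) = (\<integral>x. f x \<partial>distr (\<mu> \<Otimes>\<^sub>M \<nu>) \<mu> fst)"
    by (simp add: prob_space.distr_pair_fst[OF assms(1)])
  then show ?thesis by (simp add: integral_distr)
qed

lemma integral_pair_snd:
  fixes f :: "'a \<Rightarrow> real"
  assumes "prob_space \<mu>" "prob_space \<nu>" and [measurable]: "f \<in> borel_measurable \<nu>"
  shows "(\<integral>z. f (snd z) \<partial>(\<mu> \<Otimes>\<^sub>M \<nu>)) = (\<integral>x. f x \<partial>\<nu>)"
proof -
  interpret \<mu>: prob_space \<mu> by fact
  interpret \<nu>: prob_space \<nu> by fact
  interpret pair_prob_space \<mu> \<nu> ..
  show ?thesis
    by (subst distr_pair_swap, subst integral_distr)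
       (auto simp: integral_pair_fst[OF assms(1)] split_beta')
qed

text \<open>For indicators this is \<open>emeasure_mixture\<close>; sums, scaling and monotone
  limits preserve it.\<close>

lemma nn_integral_mixture:
  assumes sets: "sets \<mu> = sets \<nu>" and f: "f \<in> borel_measurable \<mu>"
  shows "(\<integral>\<^sup>+x. f x \<partial>mixture c \<mu> \<nu>) = ennreal c * (\<integral>\<^sup>+x. f x \<partial>\<mu>) + ennreal (1 - c) * (\<integral>\<^sup>+x. f x \<partial>\<nu>)"
proof -
  have [measurable_cong]: "sets (mixture c \<mu> \<nu>) = sets \<mu>" "sets \<nu> = sets \<mu>"
    using sets by simp_all
  have sp: "space \<nu> = space \<mu>" using sets sets_eq_imp_space_eq by metis
  show ?thesis using f
  proof (induct rule: borel_measurable_induct)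
    case (cong f g)
    moreover have "integral\<^sup>N m f = integral\<^sup>N m g" if "space m = space \<mu>" for m
      using cong(3) that by (intro nn_integral_cong) simp
    ultimately show ?case by (simp add: sp)
  next
    case (set A)
    moreover have "A \<in> sets \<nu>" using set unfolding sets .
    ultimately show ?case by (simp add: emeasure_mixture[OF sets])
  next
    case (mult u a)
    have [measurable]: "u \<in> borel_measurable \<mu>" by fact
    show ?case using mult by (simp add: nn_integral_cmult distrib_left mult.left_commute)
  next
    case (add u v)
    have [measurable]: "u \<in> borel_measurable \<mu>" "v \<in> borel_measurable \<mu>" by fact+
    show ?case using add by (simp add: nn_integral_add distrib_left add_ac)
  next
    case (seq U)
    have [measurable]: "U i \<in> borel_measurable \<mu>" for i by fact
    \<comment> \<open>Splitting the supremum of a sum into two suprema uses that both summands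
      increase in \<open>i\<close>.\<close>
    have inc: "incseq (\<lambda>i. ennreal a * integral\<^sup>N m (U i))" for a m
      using seq by (auto simp: incseq_def le_fun_def intro!: mult_left_mono nn_integral_mono)
    show ?case
      using seq by (simp add: SUP_apply[abs_def] nn_integral_monotone_convergence_SUP
          SUP_mult_left_ennreal ennreal_SUP_add inc image_comp)
  qed
qed

lemma integral_mixture:
  fixes f :: "'a \<Rightarrow> real"
  assumes sets: "sets \<mu> = sets \<nu>" and c: "0 \<le> c" "c \<le> 1"
    and f: "integrable \<mu> f" "integrable \<nu> f"
  shows "(\<integral>x. f x \<partial>mixture c \<mu> \<nu>) = c * (\<integral>x. f x \<partial>\<mu>) + (1 - c) * (\<integral>x. f x \<partial>\<nu>)"
proof -
  have [measurable_cong]: "sets (mixture c \<mu> \<nu>) = sets \<mu>" "sets \<nu> = sets \<mu>"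
    using sets by simp_all
  note [measurable] = borel_measurable_integrable[OF f(1)]
  \<comment> \<open>The integral is a difference of two \<open>enn2real\<close> values, of
    \<open>f\<close> and of \<open>- f\<close>; finiteness of each part lets \<open>enn2real\<close>
    distribute over the sum coming from the mixture.\<close>
  have fin: "(\<integral>\<^sup>+x. ennreal (g x) \<partial>m) < \<infinity>" if "integrable m g" for g :: "'a \<Rightarrow> real" and m
  proof -
    have "(\<integral>\<^sup>+x. ennreal (g x) \<partial>m) \<le> (\<integral>\<^sup>+x. ennreal (norm (g x)) \<partial>m)"
      by (intro nn_integral_mono ennreal_leI) auto
    with that show ?thesis by (auto simp: integrable_iff_bounded)
  qed
  have fm: "integrable \<mu> (\<lambda>x. - f x)" "integrable \<nu> (\<lambda>x. - f x)" using f by auto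
  have int: "integrable (mixture c \<mu> \<nu>) f"
    unfolding integrable_iff_bounded using f c
    by (auto simp: integrable_iff_bounded nn_integral_mixture sets ennreal_mult_less_top)
  show ?thesis
    unfolding real_lebesgue_integral_def[OF int] real_lebesgue_integral_def[OF f(1)]
      real_lebesgue_integral_def[OF f(2)]
    using c fin[OF f(1)] fin[OF f(2)] fin[OF fm(1)] fin[OF fm(2)]
    by (simp add: nn_integral_mixture sets enn2real_plus enn2real_mult ennreal_mult_less_top algebra_simps)
qed

text \<open>The definition tests only families indexed by \<open>i < n\<close>; an enumeration of
  \<open>I\<close> carries it over to any finite index set, such as the set of pairs in
  \<open>cross_form_nonneg\<close>.\<close>

lemma positive_definite_kernel_sum_nonneg:
  assumes h: "positive_definite_kernel S h" and I: "finite I" and x: "\<And>i. i \<in> I \<Longrightarrow> x i \<in> S"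
  shows "0 \<le> (\<Sum>i\<in>I. \<Sum>j\<in>I. c i * h (x i) (x j) * c j)"
proof -
  obtain e where e: "bij_betw e {..<card I} I"
    using ex_bij_betw_nat_finite[OF I] by (auto simp: atLeast0LessThan)
  then have "x (e i) \<in> S" if "i < card I" for i
    using that x bij_betwE by blast
  then have "0 \<le> (\<Sum>i<card I. \<Sum>j<card I. c (e i) * h (x (e i)) (x (e j)) * c (e j))"
    using h[unfolded positive_definite_kernel_def psd_matrix_def, rule_format,
        of "card I" "\<lambda>i. x (e i)", THEN conjunct2, rule_format, of "\<lambda>i. c (e i)"] by simp
  also have "\<dots> = (\<Sum>i<card I. \<Sum>j\<in>I. c (e i) * h (x (e i)) (x j) * c j)"
    by (intro sum.cong refl sum.reindex_bij_betw[OF e])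
  also have "\<dots> = (\<Sum>i\<in>I. \<Sum>j\<in>I. c i * h (x i) (x j) * c j)"
    by (intro sum.reindex_bij_betw[OF e])
  finally show ?thesis .
qed

section \<open>Energy and mutual energy for a bounded positive definite kernel\<close>

locale bounded_pd_kernel =
  fixes N :: "'a measure" and h :: "'a \<Rightarrow> 'a \<Rightarrow> real" and C :: real
  assumes measurable_kernel [measurable]: "case_prod h \<in> borel_measurable (N \<Otimes>\<^sub>M N)"
    and nonneg: "\<And>x y. x \<in> space N \<Longrightarrow> y \<in> space N \<Longrightarrow> 0 \<le> h x y"
    and bounded: "\<And>x y. x \<in> space N \<Longrightarrow> y \<in> space N \<Longrightarrow> h x y \<le> C"
    and sym: "\<And>x y. x \<in> space N \<Longrightarrow> y \<in> space N \<Longrightarrow> h x y = h y x"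
    and pd: "positive_definite_kernel (space N) h"
begin

text \<open>The mutual energy: the bilinear form whose diagonal is \<open>Phi h\<close>.\<close>

definition cross :: "'a measure \<Rightarrow> 'a measure \<Rightarrow> real" where
  "cross \<mu> \<nu> = (\<integral>x. (\<integral>y. h x y \<partial>\<nu>) \<partial>\<mu>)"

lemma Phi_eq_cross: "Phi h \<mu> = cross \<mu> \<mu>"
  by (simp add: Phi_def cross_def)

lemma measurable_kernel_compose [measurable (raw)]:
  assumes "f \<in> measurable L N" "g \<in> measurable L N"
  shows "(\<lambda>z. h (f z) (g z)) \<in> borel_measurable L"
proof -
  have "(\<lambda>z. case_prod h (f z, g z)) \<in> borel_measurable L" using assms by measurable
  then show ?thesis by simp
qed

lemma abs_le: "x \<in> space N \<Longrightarrow> y \<in> space N \<Longrightarrow> \<bar>h x y\<bar> \<le> C"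
  using nonneg bounded by fastforce

lemma integrable_kernel:
  assumes "prob_space L" "f \<in> measurable L N" "g \<in> measurable L N"
  shows "integrable L (\<lambda>z. h (f z) (g z))"
proof -
  interpret L: prob_space L by fact
  show ?thesis
    using assms(2,3) measurable_space[OF assms(2)] measurable_space[OF assms(3)]
    by (intro L.integrable_const_bound[where B=C] AE_I2) (auto intro: abs_le)
qed

lemma
  assumes "prob_space \<mu>" "sets \<mu> = sets N" "x \<in> space N"
  shows integral_kernel_nonneg: "0 \<le> (\<integral>y. h x y \<partial>\<mu>)"
    and integral_kernel_le: "(\<integral>y. h x y \<partial>\<mu>) \<le> C"
proof -
  interpret \<mu>: prob_space \<mu> by fact
  have [measurable_cong]: "sets \<mu> = sets N" by fact
  have sp: "space \<mu> = space N" using assms(2) by (rule sets_eq_imp_space_eq)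
  show "0 \<le> (\<integral>y. h x y \<partial>\<mu>)"
    using assms(3) by (intro Bochner_Integration.integral_nonneg nonneg) (auto simp: sp)
  have "integrable \<mu> (\<lambda>y. h x y)"
    using assms(3) by (intro integrable_kernel \<mu>.prob_space_axioms) auto
  then show "(\<integral>y. h x y \<partial>\<mu>) \<le> C"
    using assms(3) by (intro \<mu>.integral_le_const AE_I2 bounded) (auto simp: sp)
qed

lemma measurable_integral_kernel:
  assumes "prob_space \<mu>" "sets \<mu> = sets N"
  shows "(\<lambda>x. \<integral>y. h x y \<partial>\<mu>) \<in> borel_measurable N"
proof -
  interpret \<mu>: prob_space \<mu> by fact
  have [measurable_cong]: "sets \<mu> = sets N" by fact
  show ?thesis by measurable
qed

lemma integrable_integral_kernel:
  assumes "prob_space \<mu>" "sets \<mu> = sets N" "prob_space \<nu>" "sets \<nu> = sets N"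
  shows "integrable \<nu> (\<lambda>x. \<integral>y. h x y \<partial>\<mu>)"
proof -
  interpret \<nu>: prob_space \<nu> by fact
  have [measurable_cong]: "sets \<nu> = sets N" by fact
  have sp: "space \<nu> = space N" using assms(4) by (rule sets_eq_imp_space_eq)
  note [measurable] = measurable_integral_kernel[OF assms(1,2)]
  show ?thesis
    using integral_kernel_nonneg[OF assms(1,2)] integral_kernel_le[OF assms(1,2)]
    by (intro \<nu>.integrable_const_bound[where B=C] AE_I2) (auto simp: sp)
qed

lemma cross_sym:
  assumes "prob_space \<mu>" "sets \<mu> = sets N" "prob_space \<nu>" "sets \<nu> = sets N"
  shows "cross \<mu> \<nu> = cross \<nu> \<mu>"
proof -
  interpret \<mu>: prob_space \<mu> by fact
  interpret \<nu>: prob_space \<nu> by fact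
  interpret pair_prob_space \<mu> \<nu> ..
  have [measurable_cong]: "sets \<mu> = sets N" "sets \<nu> = sets N" by fact+
  have sp: "space \<mu> = space N" "space \<nu> = space N"
    using assms(2,4) by (auto dest: sets_eq_imp_space_eq)
  have "cross \<mu> \<nu> = (\<integral>y. (\<integral>x. h x y \<partial>\<mu>) \<partial>\<nu>)"
    unfolding cross_def
    by (intro Fubini_integral[symmetric])
       (auto simp: split_beta' intro!: integrable_kernel P.prob_space_axioms)
  also have "\<dots> = cross \<nu> \<mu>"
    unfolding cross_def by (intro Bochner_Integration.integral_cong refl sym) (auto simp: sp)
  finally show ?thesis .
qed

text \<open>Each draw from the product law supplies one point of either measure, weighted by
  \<open>a\<close> and \<open>b\<close>. \<open>K\<close> collects the four interactions between two
  draws, so its sums over draws are quadratic forms of \<open>h\<close> and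
  \<open>double_integral_nonneg_if_sums_nonneg\<close> applies.\<close>

lemma cross_form_nonneg:
  assumes \<mu>: "prob_space \<mu>" "sets \<mu> = sets N" and \<nu>: "prob_space \<nu>" "sets \<nu> = sets N"
  shows "0 \<le> a\<^sup>2 * cross \<mu> \<mu> + 2 * a * b * cross \<mu> \<nu> + b\<^sup>2 * cross \<nu> \<nu>"
proof -
  interpret \<mu>: prob_space \<mu> by fact
  interpret \<nu>: prob_space \<nu> by fact
  interpret pair_prob_space \<mu> \<nu> ..
  have [measurable_cong]: "sets \<mu> = sets N" "sets \<nu> = sets N" by fact+
  have sp: "space \<mu> = space N" "space \<nu> = space N"
    using assms(2,4) by (auto dest: sets_eq_imp_space_eq)
  define L where "L = \<mu> \<Otimes>\<^sub>M \<nu>"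
  have L: "prob_space L" by (simp add: L_def P.prob_space_axioms)
  have [measurable]: "fst \<in> measurable L N" "snd \<in> measurable L N"
    unfolding L_def by measurable
  have spL: "fst z \<in> space N" "snd z \<in> space N" if "z \<in> space L" for z
    using that by (auto simp: L_def space_pair_measure sp)
  define K where "K z z' = a * a * h (fst z) (fst z') + a * b * h (fst z) (snd z')
      + (b * a * h (snd z) (fst z') + b * b * h (snd z) (snd z'))" for z z'
  have "0 \<le> (\<integral>z. (\<integral>z'. K z z' \<partial>L) \<partial>L)"
  proof (rule double_integral_nonneg_if_sums_nonneg[OF L])
    show "case_prod K \<in> borel_measurable (L \<Otimes>\<^sub>M L)"
      unfolding K_def split_beta' by measurable
    fix z z' assume z: "z \<in> space L" "z' \<in> space L"
    have le: "\<bar>s * h u v\<bar> \<le> \<bar>s\<bar> * C" if "u \<in> space N" "v \<in> space N" for s u v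
      using abs_le[OF that] by (simp add: abs_mult mult_left_mono)
    show "\<bar>K z z'\<bar> \<le> \<bar>a * a\<bar> * C + \<bar>a * b\<bar> * C + (\<bar>b * a\<bar> * C + \<bar>b * b\<bar> * C)"
      unfolding K_def using z
      by (intro order_trans[OF abs_triangle_ineq] add_mono le) (auto intro: spL)
  next
    fix n :: nat and z assume z: "\<And>i. i < n \<Longrightarrow> z i \<in> space L"
    \<comment> \<open>Draw \<open>i\<close> contributes two points: \<open>(i, True)\<close> indexes
      its first component with weight \<open>a\<close>, \<open>(i, False)\<close> its second with
      weight \<open>b\<close>.\<close>
    have "0 \<le> (\<Sum>p\<in>{..<n} \<times> UNIV. \<Sum>q\<in>{..<n} \<times> UNIV.
        (if snd p then a else b) * h (if snd p then fst (z (fst p)) else snd (z (fst p)))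
          (if snd q then fst (z (fst q)) else snd (z (fst q))) * (if snd q then a else b))"
      using z by (intro positive_definite_kernel_sum_nonneg[OF pd]) (auto intro!: spL)
    also have "\<dots> = (\<Sum>i<n. \<Sum>j<n. K (z i) (z j))"
      by (simp add: sum.cartesian_product' UNIV_bool K_def sum.distrib algebra_simps)
    finally show "0 \<le> (\<Sum>i<n. \<Sum>j<n. K (z i) (z j))" .
  qed
  \<comment> \<open>For fixed \<open>z\<close>, each term of \<open>K z z'\<close> depends on a
    single component of \<open>z'\<close>, so integrating over \<open>z'\<close> only sees a
    marginal. The outer integral is then treated in the same way.\<close>
  also have "(\<integral>z. (\<integral>z'. K z z' \<partial>L) \<partial>L) = (\<integral>z. a * a * (\<integral>y. h (fst z) y \<partial>\<mu>) + a * b * (\<integral>y. h (fst z) y \<partial>\<nu>)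
      + (b * a * (\<integral>y. h (snd z) y \<partial>\<mu>) + b * b * (\<integral>y. h (snd z) y \<partial>\<nu>)) \<partial>L)"
  proof (intro Bochner_Integration.integral_cong refl)
    fix z assume z: "z \<in> space L"
    have i: "integrable L (\<lambda>z'. h u (fst z'))" "integrable L (\<lambda>z'. h u (snd z'))" if "u \<in> space N" for u
      using that by (auto intro!: integrable_kernel[OF L])
    have f: "(\<integral>z'. h u (fst z') \<partial>L) = (\<integral>y. h u y \<partial>\<mu>)" if "u \<in> space N" for u
      unfolding L_def using that by (intro integral_pair_fst \<nu>) measurable
    have s: "(\<integral>z'. h u (snd z') \<partial>L) = (\<integral>y. h u y \<partial>\<nu>)" if "u \<in> space N" for u
      unfolding L_def using that by (intro integral_pair_snd \<mu> \<nu>) measurable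
    show "(\<integral>z'. K z z' \<partial>L) = a * a * (\<integral>y. h (fst z) y \<partial>\<mu>) + a * b * (\<integral>y. h (fst z) y \<partial>\<nu>)
      + (b * a * (\<integral>y. h (snd z) y \<partial>\<mu>) + b * b * (\<integral>y. h (snd z) y \<partial>\<nu>))"
      unfolding K_def using spL[OF z] by (simp add: i f s)
  qed
  also have "\<dots> = a * a * cross \<mu> \<mu> + a * b * cross \<mu> \<nu> + (b * a * cross \<nu> \<mu> + b * b * cross \<nu> \<nu>)"
  proof -
    have int: "integrable L (\<lambda>z. \<integral>y. h (t z) y \<partial>m)" if t: "t \<in> measurable L N" and m: "prob_space m" "sets m = sets N" for t m
    proof -
      interpret L: prob_space L by fact
      note [measurable] = t measurable_integral_kernel[OF m]
      show ?thesis
        using integral_kernel_nonneg[OF m] integral_kernel_le[OF m] measurable_space[OF t]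
        by (intro L.integrable_const_bound[where B=C] AE_I2) auto
    qed
    have f: "(\<integral>z. (\<integral>y. h (fst z) y \<partial>m) \<partial>L) = cross \<mu> m" if "prob_space m" "sets m = sets N" for m
      unfolding L_def cross_def using measurable_integral_kernel[OF that] 
      by (intro integral_pair_fst \<nu>) measurable
    have s: "(\<integral>z. (\<integral>y. h (snd z) y \<partial>m) \<partial>L) = cross \<nu> m" if "prob_space m" "sets m = sets N" for m
      unfolding L_def cross_def using measurable_integral_kernel[OF that] 
      by (intro integral_pair_snd \<mu> \<nu>) measurable
    show ?thesis
      by (simp add: int f s \<mu> \<nu>)
  qed
  finally show ?thesis
    using cross_sym[OF \<mu> \<nu>] by (simp add: power2_eq_square algebra_simps)
qed

text \<open>Applying \<open>integral_mixture\<close> to the inner and then the outer integral gives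
  four mutual energies, of which the two mixed ones agree by \<open>cross_sym\<close>.\<close>

lemma Phi_mixture:
  assumes \<mu>: "prob_space \<mu>" "sets \<mu> = sets N" and \<nu>: "prob_space \<nu>" "sets \<nu> = sets N"
    and c: "0 \<le> c" "c \<le> 1"
  shows "Phi h (mixture c \<mu> \<nu>) = c\<^sup>2 * Phi h \<mu> + 2 * c * (1 - c) * cross \<mu> \<nu> + (1 - c)\<^sup>2 * Phi h \<nu>"
proof -
  have [measurable_cong]: "sets \<mu> = sets N" "sets \<nu> = sets N" by fact+
  have sp: "space \<mu> = space N" using \<mu>(2) by (rule sets_eq_imp_space_eq)
  have eq: "sets \<mu> = sets \<nu>" using \<mu> \<nu> by simp
  have i: "integrable m (\<lambda>y. h x y)" if "x \<in> space N" "prob_space m" "sets m = sets N" for x m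
  proof -
    have [measurable_cong]: "sets m = sets N" by fact
    show ?thesis using that(1) by (intro integrable_kernel[OF that(2)]) measurable
  qed
  have "Phi h (mixture c \<mu> \<nu>) =
      (\<integral>x. c * (\<integral>y. h x y \<partial>\<mu>) + (1 - c) * (\<integral>y. h x y \<partial>\<nu>) \<partial>mixture c \<mu> \<nu>)"
    unfolding Phi_def using \<mu> \<nu> c
    by (intro Bochner_Integration.integral_cong refl integral_mixture) (auto simp: sp intro!: i)
  also have "\<dots> = c * (c * cross \<mu> \<mu> + (1 - c) * cross \<mu> \<nu>) + (1 - c) * (c * cross \<nu> \<mu> + (1 - c) * cross \<nu> \<nu>)"
    using \<mu> \<nu> by (subst integral_mixture[OF eq c]) (auto simp: cross_def integrable_integral_kernel)
  finally show ?thesis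
    using cross_sym[OF \<mu> \<nu>] by (simp add: Phi_eq_cross power2_eq_square algebra_simps)
qed

text \<open>Compare the squares: they differ only in the mixed term, which Cauchy-Schwarz
  controls.\<close>

lemma sqrt_Phi_mixture_le:
  assumes \<mu>: "prob_space \<mu>" "sets \<mu> = sets N" and \<nu>: "prob_space \<nu>" "sets \<nu> = sets N"
    and c: "0 \<le> c" "c \<le> 1"
  shows "sqrt (Phi h (mixture c \<mu> \<nu>)) \<le> c * sqrt (Phi h \<mu>) + (1 - c) * sqrt (Phi h \<nu>)"
proof -
  \<comment> \<open>The weights \<open>(1, 0)\<close> and \<open>(0, 1)\<close> isolate the two
    energies; their being nonnegative lets the roots square back to them.\<close>
  have nn: "0 \<le> Phi h \<mu>" "0 \<le> Phi h \<nu>"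
    using cross_form_nonneg[OF \<mu> \<nu>, of 1 0] cross_form_nonneg[OF \<mu> \<nu>, of 0 1]
    by (auto simp: Phi_eq_cross)
  have "cross \<mu> \<nu> \<le> sqrt (Phi h \<mu>) * sqrt (Phi h \<nu>)"
    unfolding Phi_eq_cross by (intro cauchy_schwarz_of_nonneg_form cross_form_nonneg \<mu> \<nu>)
  then have "2 * c * (1 - c) * cross \<mu> \<nu> \<le> 2 * c * (1 - c) * (sqrt (Phi h \<mu>) * sqrt (Phi h \<nu>))"
    using c by (intro mult_left_mono) auto
  moreover have "(c * sqrt (Phi h \<mu>) + (1 - c) * sqrt (Phi h \<nu>))\<^sup>2 = c\<^sup>2 * Phi h \<mu>
      + 2 * c * (1 - c) * (sqrt (Phi h \<mu>) * sqrt (Phi h \<nu>)) + (1 - c)\<^sup>2 * Phi h \<nu>"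
    using nn by (simp add: power2_sum power_mult_distrib mult_ac)
  ultimately have "Phi h (mixture c \<mu> \<nu>) \<le> (c * sqrt (Phi h \<mu>) + (1 - c) * sqrt (Phi h \<nu>))\<^sup>2"
    unfolding Phi_mixture[OF assms] by linarith
  moreover have "0 \<le> c * sqrt (Phi h \<mu>) + (1 - c) * sqrt (Phi h \<nu>)"
    using c nn by simp
  ultimately show ?thesis by (intro real_le_lsqrt) auto
qed

end

subsection \<open>V-statistics and leave-one-out averages\<close>

text \<open>Drawing an index uniformly from \<open>{1..t}\<close> and reading off the sample point
  turns integrals against the empirical measure into finite averages.\<close>

lemma empirical_measure_eq_distr:
  assumes "1 \<le> t" and X: "\<And>i. i \<in> {1..t} \<Longrightarrow> X i \<omega> \<in> S"
  shows "empirical_measure S X t \<omega> = distr (uniform_count_measure {1..t}) (borel_on S) (\<lambda>i. X i \<omega>)"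
proof (rule measure_eqI)
  fix A assume "A \<in> sets (empirical_measure S X t \<omega>)"
  then have A: "A \<in> sets (borel_on S)" by simp
  have X': "(\<lambda>i. X i \<omega>) \<in> measurable (uniform_count_measure {1..t}) (borel_on S)"
    using X by (auto simp: measurable_def space_restrict_space sets_uniform_count_measure
        space_uniform_count_measure)
  have "(\<Sum>i=1..t. emeasure (return (borel_on S) (X i \<omega>)) A) = (\<Sum>i\<in>{1..t}. indicator ((\<lambda>i. X i \<omega>) -` A) i)"
    using A by (intro sum.cong) (auto simp: indicator_def)
  also have "\<dots> = of_nat (card ((\<lambda>i. X i \<omega>) -` A \<inter> {1..t}))"
    by (simp add: indicator_def vimage_def Int_commute)
  finally show "emeasure (empirical_measure S X t \<omega>) A =
      emeasure (distr (uniform_count_measure {1..t}) (borel_on S) (\<lambda>i. X i \<omega>)) A"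
    using assms(1)
    by (simp add: emeasure_empirical_measure[OF A] emeasure_distr[OF X' A]
        space_uniform_count_measure emeasure_uniform_count_measure divide_ennreal[symmetric]
        ennreal_of_nat_eq_real_of_nat del: One_nat_def)
qed simp

lemma integral_empirical_measure:
  fixes f :: "'a::topological_space \<Rightarrow> real"
  assumes "1 \<le> t" and X: "\<And>i. i \<in> {1..t} \<Longrightarrow> X i \<omega> \<in> S" and f: "f \<in> borel_measurable (borel_on S)"
  shows "(\<integral>x. f x \<partial>empirical_measure S X t \<omega>) = (\<Sum>i=1..t. f (X i \<omega>)) / real t"
proof -
  have "(\<lambda>i. X i \<omega>) \<in> measurable (uniform_count_measure {1..t}) (borel_on S)"
    using X by (auto simp: measurable_def space_restrict_space sets_uniform_count_measure
        space_uniform_count_measure)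
  moreover have "empirical_measure S X t \<omega> = distr (uniform_count_measure {1..t}) (borel_on S) (\<lambda>i. X i \<omega>)"
    by (intro empirical_measure_eq_distr assms)
  ultimately show ?thesis
    by (simp add: integral_distr f integral_uniform_count_measure del: One_nat_def)
qed

text \<open>The V-statistic of the subsample indexed by \<open>I\<close>; general index sets make
  room for samples with a point left out. For empty \<open>I\<close> the value is 0, by division by
  0.\<close>

definition kernel_mean :: "('a \<Rightarrow> 'a \<Rightarrow> real) \<Rightarrow> 'i set \<Rightarrow> ('i \<Rightarrow> 'a) \<Rightarrow> real" where
  "kernel_mean h I x = (\<Sum>i\<in>I. \<Sum>j\<in>I. h (x i) (x j)) / (real (card I))\<^sup>2"

lemma kernel_mean_reindex:
  assumes "inj_on p I"
  shows "kernel_mean h I (\<lambda>i. x (p i)) = kernel_mean h (p ` I) x"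
  using assms by (simp add: kernel_mean_def sum.reindex card_image)

lemma V_stat_eq_kernel_mean:
  fixes S :: "'a::topological_space set"
  assumes t: "1 \<le> t" and X: "\<And>i. i \<in> {1..t} \<Longrightarrow> X i \<omega> \<in> S"
    and h: "case_prod h \<in> borel_measurable (borel_on S \<Otimes>\<^sub>M borel_on S)"
  shows "V_stat S h X t \<omega> = kernel_mean h {1..t} (\<lambda>i. X i \<omega>)"
proof -
  have [measurable]: "h u \<in> borel_measurable (borel_on S)" "(\<lambda>x. h x u) \<in> borel_measurable (borel_on S)"
    if "u \<in> S" for u
    using that measurable_compose[OF _ h, of "\<lambda>y. (u, y)"] measurable_compose[OF _ h, of "\<lambda>x. (x, u)"]
    by (auto simp: space_restrict_space)
  have "V_stat S h X t \<omega> =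
      (\<integral>x. (\<Sum>j=1..t. h x (X j \<omega>)) / real t \<partial>empirical_measure S X t \<omega>)"
    unfolding V_stat_def Phi_def
    by (intro Bochner_Integration.integral_cong refl integral_empirical_measure t X) auto
  also have "\<dots> = (\<Sum>i=1..t. (\<Sum>j=1..t. h (X i \<omega>) (X j \<omega>)) / real t) / real t"
    using X by (intro integral_empirical_measure t X) auto
  also have "\<dots> = kernel_mean h {1..t} (\<lambda>i. X i \<omega>)"
    by (simp add: kernel_mean_def sum_divide_distrib power2_eq_square)
  finally show ?thesis .
qed

section \<open>The root of a semidefinite form as a seminorm\<close>

definition quad_form :: "'i set \<Rightarrow> ('i \<Rightarrow> 'i \<Rightarrow> real) \<Rightarrow> ('i \<Rightarrow> real) \<Rightarrow> ('i \<Rightarrow> real) \<Rightarrow> real" where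
  "quad_form I a c d = (\<Sum>i\<in>I. \<Sum>j\<in>I. c i * a i j * d j)"

text \<open>By Cauchy-Schwarz the mixed part of the expanded form is at most twice the product of
  the two roots, which completes the square.\<close>

lemma sqrt_quad_form_triangle:
  assumes sym: "\<And>i j. i \<in> I \<Longrightarrow> j \<in> I \<Longrightarrow> a i j = a j i"
    and psd: "\<And>c. 0 \<le> quad_form I a c c"
  shows "sqrt (quad_form I a (\<lambda>i. c i + d i) (\<lambda>i. c i + d i))
    \<le> sqrt (quad_form I a c c) + sqrt (quad_form I a d d)"
proof -
  have swap: "quad_form I a d c = quad_form I a c d"
    unfolding quad_form_def by (subst sum.swap) (auto intro!: sum.cong simp: sym mult_ac)
  \<comment> \<open>General \<open>r\<close> and \<open>s\<close> serve the hypothesis of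
    Cauchy-Schwarz, the case \<open>r = s = 1\<close> the sum itself.\<close>
  have expand: "quad_form I a (\<lambda>i. r * c i + s * d i) (\<lambda>i. r * c i + s * d i) =
      r\<^sup>2 * quad_form I a c c + 2 * r * s * quad_form I a c d + s\<^sup>2 * quad_form I a d d" for r s
  proof -
    have "quad_form I a (\<lambda>i. r * c i + s * d i) (\<lambda>i. r * c i + s * d i) =
        r\<^sup>2 * quad_form I a c c + r * s * quad_form I a c d + s * r * quad_form I a d c
          + s\<^sup>2 * quad_form I a d d"
      by (simp add: quad_form_def sum_distrib_left sum.distrib[symmetric] power2_eq_square algebra_simps)
    then show ?thesis by (simp add: swap)
  qed
  have "quad_form I a c d \<le> sqrt (quad_form I a c c) * sqrt (quad_form I a d d)"
    by (rule cauchy_schwarz_of_nonneg_form) (use psd in \<open>simp flip: expand\<close>)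
  then have "quad_form I a (\<lambda>i. c i + d i) (\<lambda>i. c i + d i)
      \<le> (sqrt (quad_form I a c c) + sqrt (quad_form I a d d))\<^sup>2"
    using expand[of 1 1] psd by (simp add: power2_sum)
  then show ?thesis
    using psd by (intro real_le_lsqrt) auto
qed

lemma sqrt_quad_form_sum_le:
  assumes sym: "\<And>i j. i \<in> I \<Longrightarrow> j \<in> I \<Longrightarrow> a i j = a j i"
    and psd: "\<And>c. 0 \<le> quad_form I a c c" and "finite F"
  shows "sqrt (quad_form I a (\<lambda>i. \<Sum>k\<in>F. c k i) (\<lambda>i. \<Sum>k\<in>F. c k i))
    \<le> (\<Sum>k\<in>F. sqrt (quad_form I a (c k) (c k)))"
  using assms(3)
proof (induction F rule: finite_induct)
  case empty
  show ?case by (simp add: quad_form_def)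
next
  case (insert k F)
  then show ?case
    using sqrt_quad_form_triangle[OF sym psd, of "c k" "\<lambda>i. \<Sum>k\<in>F. c k i"] by simp
qed

context bounded_pd_kernel
begin

text \<open>The absolute value in the bound covers empty \<open>I\<close>, where the mean is 0 while
  nothing rules out \<open>C < 0\<close>.\<close>

lemma kernel_mean_bounds:
  assumes "finite I" and x: "\<And>i. i \<in> I \<Longrightarrow> x i \<in> space N"
  shows "0 \<le> kernel_mean h I x" and "kernel_mean h I x \<le> \<bar>C\<bar>"
proof -
  show "0 \<le> kernel_mean h I x"
    using x by (auto simp: kernel_mean_def intro!: divide_nonneg_nonneg sum_nonneg nonneg)
  have "(\<Sum>i\<in>I. \<Sum>j\<in>I. h (x i) (x j)) \<le> (\<Sum>i\<in>I. \<Sum>j\<in>I. \<bar>C\<bar>)"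
    using x by (intro sum_mono order_trans[OF bounded]) auto
  then show "kernel_mean h I x \<le> \<bar>C\<bar>"
    by (cases "card I = 0") (auto simp: kernel_mean_def divide_le_eq power2_eq_square mult_ac)
qed

text \<open>The indicators of the sets \<open>I - {k}\<close> add up to \<open>card I - 1\<close> times the indicator of \<open>I\<close>.\<close>

lemma sqrt_kernel_mean_le_leave_one_out:
  assumes I: "finite I" "2 \<le> card I" and x: "\<And>i. i \<in> I \<Longrightarrow> x i \<in> space N"
  shows "sqrt (kernel_mean h I x) \<le> (\<Sum>k\<in>I. sqrt (kernel_mean h (I - {k}) x)) / card I"
proof -
  let ?Q = "quad_form I (\<lambda>i j. h (x i) (x j))"
  let ?s = "\<lambda>J. \<Sum>i\<in>J. \<Sum>j\<in>J. h (x i) (x j)"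
  let ?c = "\<lambda>k i. if i = k then 0 else 1 :: real"
  \<comment> \<open>The size of each \<open>I - {k}\<close>; it is positive because
    \<open>card I\<close> is at least 2, so it may be divided by.\<close>
  define m where "m = real (card I) - 1"
  have m: "0 < m" "real (card I) = m + 1" using I by (auto simp: m_def)
  have card: "real (card (I - {k})) = m" if "k \<in> I" for k
    using that I by (simp add: m_def card_Diff_singleton of_nat_diff)
  have psd: "0 \<le> ?Q c c" for c
    unfolding quad_form_def by (intro positive_definite_kernel_sum_nonneg[OF pd] I x)
  have Qc: "?Q (?c k) (?c k) = ?s (I - {k})" if "k \<in> I" for k
  proof -
    have drop: "(\<Sum>i\<in>I. (if i = k then 0 else 1) * f i) = sum f (I - {k})" for f :: "_ \<Rightarrow> real"
      using I by (intro sum.mono_neutral_cong_right) auto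
    have "?Q (?c k) (?c k) = (\<Sum>i\<in>I. ?c k i * (\<Sum>j\<in>I. ?c k j * h (x i) (x j)))"
      by (simp add: quad_form_def sum_distrib_left mult_ac)
    then show ?thesis by (simp add: drop)
  qed
  have "(\<Sum>k\<in>I. ?c k i) = m" if "i \<in> I" for i
  proof -
    have "(\<Sum>k\<in>I. ?c k i) = (\<Sum>k\<in>I - {i}. 1)"
      using I by (intro sum.mono_neutral_cong_right) auto
    then show ?thesis using card[OF that] by simp
  qed
  then have "?Q (\<lambda>i. \<Sum>k\<in>I. ?c k i) (\<lambda>i. \<Sum>k\<in>I. ?c k i) = m\<^sup>2 * ?s I"
    by (simp add: quad_form_def sum_distrib_left power2_eq_square mult_ac)
  then have "sqrt (m\<^sup>2 * ?s I) \<le> (\<Sum>k\<in>I. sqrt (?Q (?c k) (?c k)))"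
    using sqrt_quad_form_sum_le[of I "\<lambda>i j. h (x i) (x j)" I ?c] psd I sym x by simp
  then have main: "m * sqrt (?s I) \<le> (\<Sum>k\<in>I. sqrt (?s (I - {k})))"
    using m by (simp add: real_sqrt_mult Qc cong: sum.cong)
  have drop: "sqrt (kernel_mean h (I - {k}) x) = sqrt (?s (I - {k})) / m" if "k \<in> I" for k
    using m that by (simp add: kernel_mean_def real_sqrt_divide card)
  \<comment> \<open>Extending by \<open>m\<close> yields a denominator that splits into
    \<open>m\<close>, the scale of the roots on \<open>I - {k}\<close>, and \<open>m + 1\<close>,
    the number of terms averaged.\<close>
  have "sqrt (kernel_mean h I x) = m * sqrt (?s I) / (m * (m + 1))"
    using m by (simp add: kernel_mean_def real_sqrt_divide)
  also have "\<dots> \<le> (\<Sum>k\<in>I. sqrt (?s (I - {k}))) / (m * (m + 1))"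
    using m by (intro divide_right_mono main) auto
  also have "\<dots> = (\<Sum>k\<in>I. sqrt (kernel_mean h (I - {k}) x)) / card I"
    using m by (simp add: drop sum_divide_distrib[symmetric] cong: sum.cong)
  finally show ?thesis .
qed

lemma kernel_mean_le_leave_one_out:
  assumes I: "finite I" "2 \<le> card I" and x: "\<And>i. i \<in> I \<Longrightarrow> x i \<in> space N"
  shows "kernel_mean h I x \<le> (\<Sum>k\<in>I. kernel_mean h (I - {k}) x) / card I"
proof -
  let ?q = "\<lambda>J. sqrt (kernel_mean h J x)"
  have sq: "(?q J)\<^sup>2 = kernel_mean h J x" if "J \<subseteq> I" for J
    using that I x kernel_mean_bounds(1)[of J x] finite_subset by auto
  have "(?q I)\<^sup>2 \<le> ((\<Sum>k\<in>I. ?q (I - {k})) / card I)\<^sup>2"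
    using I x kernel_mean_bounds(1)[of I x] by (intro power_mono sqrt_kernel_mean_le_leave_one_out) auto
  \<comment> \<open>Jensen for the square: a squared sum is at most the number of terms times the
    sum of the squares.\<close>
  also have "\<dots> \<le> ((\<Sum>k\<in>I. (?q (I - {k}))\<^sup>2) * card I) / (real (card I))\<^sup>2"
    unfolding power_divide by (intro divide_right_mono sum_squared_le_sum_of_squares) auto
  also have "(\<Sum>k\<in>I. (?q (I - {k}))\<^sup>2) = (\<Sum>k\<in>I. kernel_mean h (I - {k}) x)"
    by (intro sum.cong refl sq) auto
  also have "\<dots> * card I / (real (card I))\<^sup>2 = \<dots> / card I"
    using I by (simp add: power2_eq_square)
  finally show ?thesis using sq[of I] by simp
qed

end

subsection \<open>The exchangeable filtration\<close>

lemma exchangeable_filtration_symmetric_measurable: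
  assumes "f \<in> borel_measurable (Pi\<^sub>M {1..} (\<lambda>_. borel_on S))" "symmetric_in_first S t f"
  shows "(\<lambda>\<omega>. f (\<lambda>i\<in>{1..}. X i \<omega>)) \<in> borel_measurable (exchangeable_filtration M S X t)"
proof (rule measurableI)
  fix B :: "real set" assume "B \<in> sets borel"
  then show "(\<lambda>\<omega>. f (\<lambda>i\<in>{1..}. X i \<omega>)) -` B \<inter> space (exchangeable_filtration M S X t)
      \<in> sets (exchangeable_filtration M S X t)"
    using assms unfolding exchangeable_filtration_def
    by (subst space_measure_of, blast, subst sets_measure_of, blast)
       (intro sigma_sets.Basic, blast)
qed simp

lemma subalgebra_exchangeable_filtration:
  assumes "(\<lambda>\<omega>. \<lambda>i\<in>{1..}. X i \<omega>) \<in> measurable M (Pi\<^sub>M {1..} (\<lambda>_. borel_on S))"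
  shows "subalgebra M (exchangeable_filtration M S X t)"
  unfolding subalgebra_def
proof
  show "sets (exchangeable_filtration M S X t) \<subseteq> sets M"
    unfolding exchangeable_filtration_def
    by (subst sets_measure_of, blast, rule sets.sigma_sets_subset, clarify)
       (rule measurable_sets[OF measurable_compose[OF assms]])
qed (simp add: exchangeable_filtration_def space_measure_of_conv)

text \<open>Every permutation of \<open>{1..s}\<close> also permutes \<open>{1..t}\<close>, so
  symmetry in more arguments is the stronger condition and leaves fewer generators.\<close>

lemma exchangeable_filtration_antimono:
  assumes "s \<le> t"
  shows "sets (exchangeable_filtration M S X t) \<subseteq> sets (exchangeable_filtration M S X s)"
proof -
  have "symmetric_in_first S s f" if "symmetric_in_first S t f" for f :: "(nat \<Rightarrow> 'b) \<Rightarrow> real"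
    using that assms permutes_subset[of _ "{1..s}" "{1..t}"] by (auto simp: symmetric_in_first_def)
  then show ?thesis
    unfolding exchangeable_filtration_def
    by (subst (1 2) sets_measure_of) (blast, blast, rule sigma_sets_mono', blast)
qed

text \<open>A permutation of \<open>{1..t}\<close> fixes 0, where points of the product space are
  \<open>undefined\<close>; so the permuted sequence is still extensional and restricting it changes
  nothing.\<close>

lemma permute_in_space_PiM:
  assumes "p permutes {1..t::nat}" "x \<in> space (Pi\<^sub>M {1..} (\<lambda>_. N))"
  shows "(\<lambda>i. x (p i)) \<in> space (Pi\<^sub>M {1..} (\<lambda>_. N))"
    and "(\<lambda>i. x (p i)) = (\<lambda>i\<in>{1..}. x (p i))"
proof -
  have p: "p i \<in> {1..} \<longleftrightarrow> i \<in> {1..}" for i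
    using permutes_in_image[OF assms(1), of i] permutes_not_in[OF assms(1), of i]
    by (cases "i \<in> {1..t}") auto
  show "(\<lambda>i. x (p i)) \<in> space (Pi\<^sub>M {1..} (\<lambda>_. N))"
    using assms(2) p by (auto simp: space_PiM PiE_def extensional_def)
  show "(\<lambda>i. x (p i)) = (\<lambda>i\<in>{1..}. x (p i))"
    using assms(2) p by (auto simp: space_PiM PiE_def extensional_def fun_eq_iff)
qed

text \<open>Generators pull back sets defined by a symmetric function, which are invariant;
  complements and countable unions keep this form, so induction over the generated sigma-algebra
  applies.\<close>

lemma exchangeable_filtration_invariant_preimage:
  assumes "A \<in> sets (exchangeable_filtration M S X t)"
    and Y: "(\<lambda>\<omega>. \<lambda>i\<in>{1..}. X i \<omega>) \<in> measurable M (Pi\<^sub>M {1..} (\<lambda>_. borel_on S))"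
  obtains B where "B \<in> sets (Pi\<^sub>M {1..} (\<lambda>_. borel_on S))" "A = (\<lambda>\<omega>. \<lambda>i\<in>{1..}. X i \<omega>) -` B \<inter> space M"
    "\<And>p x. p permutes {1..t} \<Longrightarrow> x \<in> space (Pi\<^sub>M {1..} (\<lambda>_. borel_on S)) \<Longrightarrow> (\<lambda>i. x (p i)) \<in> B \<longleftrightarrow> x \<in> B"
proof -
  let ?Q = "Pi\<^sub>M {1..} (\<lambda>_. borel_on S)"
  let ?Y = "\<lambda>\<omega>. \<lambda>i\<in>{1..}. X i \<omega>"
  let ?inv = "\<lambda>B. \<forall>p x. p permutes {1..t} \<longrightarrow> x \<in> space ?Q \<longrightarrow> ((\<lambda>i. x (p i)) \<in> B \<longleftrightarrow> x \<in> B)"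
  have "A \<in> sigma_sets (space M) {(\<lambda>\<omega>. f (\<lambda>i\<in>{1..}. X i \<omega>)) -` B \<inter> space M | f B.
        f \<in> borel_measurable ?Q \<and> symmetric_in_first S t f \<and> B \<in> sets borel}"
    using assms(1) unfolding exchangeable_filtration_def by (subst (asm) sets_measure_of) auto
  then have "\<exists>B\<in>sets ?Q. A = ?Y -` B \<inter> space M \<and> ?inv B"
  proof induction
    case (Basic A)
    then obtain f B where fB: "A = (\<lambda>\<omega>. f (?Y \<omega>)) -` B \<inter> space M" "f \<in> borel_measurable ?Q"
        "symmetric_in_first S t f" "B \<in> sets borel" by blast
    \<comment> \<open>Cutting down to \<open>space ?Q\<close> makes the set measurable; invariance
      survives because permutations map the space into itself.\<close>
    have "A = ?Y -` (f -` B \<inter> space ?Q) \<inter> space M"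
      using measurable_space[OF Y] by (auto simp: fB(1))
    moreover have "?inv (f -` B \<inter> space ?Q)"
      using fB(3) permute_in_space_PiM(1) by (auto simp: symmetric_in_first_def)
    ultimately show ?case
      using measurable_sets[OF fB(2,4)] by (intro bexI[of _ "f -` B \<inter> space ?Q"] conjI)
  next
    case Empty
    show ?case by (intro bexI[of _ "{}"]) auto
  next
    case (Compl A)
    then obtain B where B: "B \<in> sets ?Q" "A = ?Y -` B \<inter> space M" "?inv B" by blast
    have "space M - A = ?Y -` (space ?Q - B) \<inter> space M"
      using measurable_space[OF Y] by (auto simp: B(2))
    moreover have "?inv (space ?Q - B)"
      using B(3) permute_in_space_PiM(1) by blast
    ultimately show ?case
      using sets.compl_sets[OF B(1)] by (intro bexI[of _ "space ?Q - B"] conjI)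
  next
    case (Union A)
    \<comment> \<open>Each \<open>A n\<close> has its own invariant set; choice fixes a sequence of
      them, whose union is again invariant.\<close>
    have "\<forall>n. \<exists>B. B \<in> sets ?Q \<and> A n = ?Y -` B \<inter> space M \<and> ?inv B"
      by (intro allI Union.IH[unfolded Bex_def])
    then obtain B where "\<forall>n. B n \<in> sets ?Q \<and> A n = ?Y -` B n \<inter> space M \<and> ?inv (B n)"
      by (rule choice[THEN exE])
    then have B: "B n \<in> sets ?Q" "A n = ?Y -` B n \<inter> space M" "?inv (B n)" for n
      by simp_all
    have "(\<Union>n. A n) = ?Y -` (\<Union>n. B n) \<inter> space M" using B(2) by auto
    moreover have "?inv (\<Union>n. B n)" using B(3) by blast
    moreover have "(\<Union>n. B n) \<in> sets ?Q" using B(1) by (intro sets.countable_UN) auto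
    ultimately show ?case by (intro bexI[of _ "\<Union>n. B n"] conjI)
  qed
  then show thesis using that by blast
qed

text \<open>With identical factors the product law is exchangeable: reindexing its coordinates
  injectively reproduces it.\<close>

lemma integral_PiM_permute:
  fixes f :: "(nat \<Rightarrow> 'a) \<Rightarrow> real"
  assumes "prob_space P" and p: "p permutes {1..t::nat}" and f: "f \<in> borel_measurable (Pi\<^sub>M {1..} (\<lambda>_. P))"
  shows "(\<integral>x. f (\<lambda>i. x (p i)) \<partial>Pi\<^sub>M {1..} (\<lambda>_. P)) = (\<integral>x. f x \<partial>Pi\<^sub>M {1..} (\<lambda>_. P))"
proof -
  let ?D = "Pi\<^sub>M {1..} (\<lambda>_. P)"
  have pin: "p \<in> {1..} \<rightarrow> {1..}"
    using permutes_in_image[OF p] permutes_not_in[OF p] by (metis Pi_I atLeastAtMost_iff atLeast_iff)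
  have "(\<lambda>x. \<lambda>i\<in>{1..}. x (p i)) \<in> measurable ?D ?D"
    using pin by (intro measurable_restrict measurable_component_singleton) auto
  then have "(\<integral>x. f x \<partial>distr ?D ?D (\<lambda>x. \<lambda>i\<in>{1..}. x (p i))) = (\<integral>x. f (\<lambda>i\<in>{1..}. x (p i)) \<partial>?D)"
    using f by (rule integral_distr)
  also have "\<dots> = (\<integral>x. f (\<lambda>i. x (p i)) \<partial>?D)"
    by (intro Bochner_Integration.integral_cong refl arg_cong[where f=f]
        permute_in_space_PiM(2)[OF p, symmetric])
  finally show ?thesis
    using distr_PiM_reindex[of "{1..}" "\<lambda>_. P" p "{1..}"] assms(1) permutes_inj_on[OF p] pin by simp
qed

text \<open>A common criterion for the V-statistic and its root, with \<open>g I\<close> the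
  statistic of the subsample \<open>I\<close>. Over an invariant event all \<open>t + 1\<close>
  leave-one-out statistics have the same integral, so their symmetric average is the conditional
  expectation of \<open>R t\<close>, and \<open>g_le\<close> compares it with
  \<open>R (t + 1)\<close>.\<close>

lemma reverse_submartingale_leave_one_out:
  fixes g :: "nat set \<Rightarrow> (nat \<Rightarrow> 'a::topological_space) \<Rightarrow> real" and S :: "'a set"
  assumes "prob_space M"
    and indep: "prob_space.indep_vars M (\<lambda>_. borel_on S) X {1..}"
    and distr: "\<And>t. 1 \<le> t \<Longrightarrow> distr M (borel_on S) (X t) = P"
    and g_meas: "\<And>I. finite I \<Longrightarrow> I \<subseteq> {1..} \<Longrightarrow> g I \<in> borel_measurable (Pi\<^sub>M {1..} (\<lambda>_. borel_on S))"
    and g_bound: "\<And>I x. finite I \<Longrightarrow> I \<subseteq> {1..} \<Longrightarrow> x \<in> space (Pi\<^sub>M {1..} (\<lambda>_. borel_on S)) \<Longrightarrow> \<bar>g I x\<bar> \<le> C"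
    and g_permute: "\<And>I t p x. p permutes {1..t} \<Longrightarrow> g I (\<lambda>i. x (p i)) = g (p ` I) x"
    and g_le: "\<And>t x. 1 \<le> t \<Longrightarrow> x \<in> space (Pi\<^sub>M {1..} (\<lambda>_. borel_on S)) \<Longrightarrow>
        g {1..t + 1} x \<le> (\<Sum>k\<in>{1..t + 1}. g ({1..t + 1} - {k}) x) / real (t + 1)"
    and R: "\<And>t \<omega>. 1 \<le> t \<Longrightarrow> \<omega> \<in> space M \<Longrightarrow> R t \<omega> = g {1..t} (\<lambda>i\<in>{1..}. X i \<omega>)"
  shows "reverse_submartingale M (exchangeable_filtration M S X) R"
proof -
  interpret prob_space M by fact
  let ?F = "exchangeable_filtration M S X"
  define Q where "Q = Pi\<^sub>M {1..} (\<lambda>_::nat. borel_on S)"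
  define Y where "Y \<omega> = (\<lambda>i\<in>{1..}. X i \<omega>)" for \<omega>
  define D where "D = Pi\<^sub>M {1..} (\<lambda>_::nat. P)"
  have rv: "random_variable (borel_on S) (X i)" if "i \<in> {1..}" for i
    using indep that by (auto simp: indep_vars_def)
  have Y [measurable]: "Y \<in> measurable M Q"
    unfolding Y_def[abs_def] Q_def by (intro measurable_restrict rv)
  have setsP: "sets P = sets (borel_on S)" using distr[of 1] by auto
  have P: "prob_space P" using prob_space_distr[OF rv[of 1]] distr[of 1] by simp
  have [measurable_cong]: "sets D = sets Q"
    unfolding D_def Q_def by (intro sets_PiM_cong) (simp_all add: setsP)
  have spD: "space D = space Q" by (rule sets_eq_imp_space_eq) fact
  \<comment> \<open>Independence and equal marginals give the whole sequence the infinite product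
    law \<open>D\<close>.\<close>
  have distrY: "distr M Q Y = D"
  proof -
    have "distr M Q Y = Pi\<^sub>M {1..} (\<lambda>i. distr M (borel_on S) (X i))"
      using indep rv unfolding Q_def Y_def[abs_def] by (subst (asm) indep_vars_iff_distr_eq_PiM') auto
    also have "\<dots> = D" unfolding D_def using distr by (intro PiM_cong) auto
    finally show ?thesis .
  qed
  note g_meas' [measurable] = g_meas[folded Q_def]
  have sub: "subalgebra M (?F t)" for t
    by (rule subalgebra_exchangeable_filtration) (use Y in \<open>simp add: Y_def[abs_def] Q_def\<close>)
  have spF: "space (?F t) = space M" for t
    using sub by (simp add: subalgebra_def)
  have int_g: "integrable M (\<lambda>\<omega>. g I (Y \<omega>))" if "finite I" "I \<subseteq> {1..}" for I
    using that g_bound[OF that] measurable_space[OF Y]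
    by (intro integrable_const_bound[where B=C] AE_I2) (auto simp: Q_def)
  have meas: "(\<lambda>\<omega>. f (Y \<omega>)) \<in> borel_measurable (?F t)"
    if "f \<in> borel_measurable Q" "symmetric_in_first S t f" for f t
    unfolding Y_def using that by (intro exchangeable_filtration_symmetric_measurable) (auto simp: Q_def)
  have int_R: "integrable M (R t)" if "1 \<le> t" for t
  proof -
    have "integrable M (R t) \<longleftrightarrow> integrable M (\<lambda>\<omega>. g {1..t} (Y \<omega>))"
      using R[OF that] by (intro Bochner_Integration.integrable_cong) (auto simp: Y_def)
    then show ?thesis using int_g[of "{1..t}"] by auto
  qed
  have meas_R: "R t \<in> borel_measurable (?F t)" if "1 \<le> t" for t
  proof -
    have "symmetric_in_first S t (g {1..t})"
      unfolding symmetric_in_first_def using g_permute permutes_image by metis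
    then have "(\<lambda>\<omega>. g {1..t} (Y \<omega>)) \<in> borel_measurable (?F t)"
      by (intro meas g_meas') auto
    then show ?thesis
      using R[OF that] by (subst measurable_cong[where g="\<lambda>\<omega>. g {1..t} (Y \<omega>)"]) (auto simp: Y_def spF)
  qed
  have "AE \<omega> in M. R (t + 1) \<omega> \<le> real_cond_exp M (?F (t + 1)) (R t) \<omega>" if t: "1 \<le> t" for t
  proof -
    interpret F: finite_measure_subalgebra M "?F (t + 1)"
      by unfold_locales (rule sub)
    let ?I = "{1..t + 1}"
    \<comment> \<open>The candidate for the conditional expectation; its term
      \<open>k = t + 1\<close> is the statistic of the first \<open>t\<close> points, that is
      \<open>R t\<close>.\<close>
    define f where "f x = (\<Sum>k\<in>?I. g (?I - {k}) x) / real (t + 1)" for x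
    have f [measurable]: "f \<in> borel_measurable Q"
      unfolding f_def[abs_def] by (intro borel_measurable_divide borel_measurable_sum g_meas') auto
    have "f (\<lambda>i. x (p i)) = f x" if p: "p permutes ?I" for p x
    proof -
      \<comment> \<open>A permutation carries the index set without \<open>k\<close> to the one
        without \<open>p k\<close>, so it only reorders the average.\<close>
      have "(\<Sum>k\<in>?I. g (p ` (?I - {k})) x) = (\<Sum>k\<in>?I. g (?I - {p k}) x)"
        using permutes_inj[OF p] permutes_image[OF p] by (simp add: image_set_diff)
      also have "\<dots> = (\<Sum>k\<in>?I. g (?I - {k}) x)"
        using sum.permute[OF p, of "\<lambda>k. g (?I - {k}) x"] by (simp add: o_def)
      finally show ?thesis by (simp add: f_def g_permute[OF p])
    qed
    then have f_sym: "symmetric_in_first S (t + 1) f" by (simp add: symmetric_in_first_def)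
    have int_f: "integrable M (\<lambda>\<omega>. f (Y \<omega>))"
      unfolding f_def by (intro Bochner_Integration.integrable_divide Bochner_Integration.integrable_sum int_g) auto
    have "AE \<omega> in M. real_cond_exp M (?F (t + 1)) (R t) \<omega> = f (Y \<omega>)"
    proof (rule F.real_cond_exp_charact)
      fix A assume A: "A \<in> sets (?F (t + 1))"
      \<comment> \<open>Through an invariant set of sequences, integrals over \<open>A\<close>
        become integrals under \<open>D\<close>, a law that permutations preserve.\<close>
      obtain B where B: "B \<in> sets Q" "A = Y -` B \<inter> space M"
        and inv: "\<And>p x. p permutes ?I \<Longrightarrow> x \<in> space Q \<Longrightarrow> (\<lambda>i. x (p i)) \<in> B \<longleftrightarrow> x \<in> B"
        using exchangeable_filtration_invariant_preimage[OF A, folded Q_def Y_def[abs_def], OF Y] by metis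
      note [measurable] = B(1)
      define J where "J u = (\<integral>x. indicator B x * u x \<partial>D)" for u :: "(nat \<Rightarrow> 'a) \<Rightarrow> real"
      have transfer: "(\<integral>\<omega>\<in>A. u (Y \<omega>) \<partial>M) = J u" if [measurable]: "u \<in> borel_measurable Q" for u
      proof -
        have "J u = (\<integral>\<omega>. indicator B (Y \<omega>) * u (Y \<omega>) \<partial>M)"
          unfolding J_def distrY[symmetric] by (subst integral_distr) auto
        also have "\<dots> = (\<integral>\<omega>\<in>A. u (Y \<omega>) \<partial>M)"
          unfolding set_lebesgue_integral_def
          by (intro Bochner_Integration.integral_cong) (auto simp: B(2) indicator_def)
        finally show ?thesis ..
      qed
      have Jg: "J (g (?I - {k})) = J (g {1..t})" if k: "k \<in> ?I" for k
      proof -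
        \<comment> \<open>Swapping \<open>k\<close> and \<open>t + 1\<close> carries
          \<open>{1..t}\<close> to the index set without \<open>k\<close>; as the swap preserves
          both \<open>B\<close> and \<open>D\<close>, it leaves \<open>J\<close> unchanged.\<close>
        define p where "p = Transposition.transpose k (t + 1)"
        have p: "p permutes ?I" unfolding p_def using k by (intro permutes_swap_id) auto
        have "p ` {1..t} = p ` (?I - {t + 1})" by (intro arg_cong[where f="image p"]) auto
        also have "\<dots> = ?I - {k}"
          using permutes_inj[OF p] permutes_image[OF p] by (simp add: image_set_diff) (simp add: p_def)
        finally have pI: "p ` {1..t} = ?I - {k}" .
        have "J (g (?I - {k})) = (\<integral>x. indicator B (\<lambda>i. x (p i)) * g {1..t} (\<lambda>i. x (p i)) \<partial>D)"
          unfolding J_def g_permute[OF p] pI using inv[OF p]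
          by (intro Bochner_Integration.integral_cong refl) (simp add: spD indicator_def)
        also have "\<dots> = J (g {1..t})"
        proof -
          have "(\<lambda>x. indicator B x * g {1..t} x) \<in> borel_measurable D"
            using g_meas'[of "{1..t}"] by measurable
          then show ?thesis
            unfolding J_def D_def by (rule integral_PiM_permute[OF P p])
        qed
        finally show ?thesis .
      qed
      have int_D: "integrable D (\<lambda>x. indicator B x * g I x)" if I: "finite I" "I \<subseteq> {1..}" for I
      proof -
        note [measurable] = g_meas'[OF I]
        have "integrable M (\<lambda>\<omega>. indicator B (Y \<omega>) * g I (Y \<omega>))"
          using g_bound[OF I] measurable_space[OF Y]
          by (intro Bochner_Integration.integrable_bound[OF int_g[OF I]]) (auto simp: indicator_def)
        then show ?thesis
          unfolding distrY[symmetric] by (subst integrable_distr_eq) auto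
      qed
      have "J f = (\<integral>x. (\<Sum>k\<in>?I. indicator B x * g (?I - {k}) x) / real (t + 1) \<partial>D)"
        unfolding J_def f_def times_divide_eq_right sum_distrib_left ..
      also have "\<dots> = (\<Sum>k\<in>?I. J (g (?I - {k}))) / real (t + 1)"
        unfolding J_def by (subst integral_divide_zero, subst Bochner_Integration.integral_sum) (auto intro!: int_D)
      also have "(\<Sum>k\<in>?I. J (g (?I - {k}))) = (\<Sum>k\<in>?I. J (g {1..t}))"
        by (intro sum.cong refl Jg)
      also have "\<dots> / real (t + 1) = J (g {1..t})"
        by simp
      finally have "J f = J (g {1..t})" .
      moreover have "(\<integral>\<omega>\<in>A. R t \<omega> \<partial>M) = (\<integral>\<omega>\<in>A. g {1..t} (Y \<omega>) \<partial>M)"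
        unfolding set_lebesgue_integral_def
        by (intro Bochner_Integration.integral_cong) (auto simp: R[OF t] Y_def)
      ultimately show "(\<integral>\<omega>\<in>A. R t \<omega> \<partial>M) = (\<integral>\<omega>\<in>A. f (Y \<omega>) \<partial>M)"
        using g_meas'[of "{1..t}"] by (auto simp: transfer)
    qed (use int_R[OF t] int_f meas[OF f f_sym] in auto)
    \<comment> \<open>Wherever the conditional expectation equals \<open>f (Y \<omega>)\<close>, the
      claim is \<open>g_le\<close> at the point \<open>Y \<omega>\<close>.\<close>
    with AE_space show ?thesis
    proof eventually_elim
      case (elim \<omega>)
      then show ?case
        using g_le[OF t, of "Y \<omega>"] measurable_space[OF Y] R[of "t + 1" \<omega>] by (simp add: f_def Q_def Y_def)
    qed
  qed
  then show ?thesis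
    unfolding reverse_submartingale_def
    using sub int_R meas_R exchangeable_filtration_antimono[of t "t + 1" M S X for t] by simp
qed

section \<open>Continuous kernels on compact sets\<close>

lemma measurable_borel_on_pair:
  fixes h :: "'a::second_countable_topology \<Rightarrow> 'a \<Rightarrow> real"
  assumes S: "closed S" and h: "continuous_on (S \<times> S) (\<lambda>(x, y). h x y)"
  shows "case_prod h \<in> borel_measurable (borel_on S \<Otimes>\<^sub>M borel_on S)"
proof -
  \<comment> \<open>Extension by 0 off the closed set \<open>S \<times> S\<close> turns continuity
    there into Borel measurability on the whole space.\<close>
  have "(\<lambda>z. indicator (S \<times> S) z *\<^sub>R case_prod h z) \<in> borel_measurable borel"
    using S h by (intro borel_measurable_continuous_on_indicator borel_closed closed_Times)
  moreover have "(\<lambda>z. z) \<in> measurable (borel_on S \<Otimes>\<^sub>M borel_on S) borel"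
  proof -
    have "(\<lambda>x. x) \<in> measurable (borel_on S) borel"
      by (intro measurable_restrict_space1) simp
    then show ?thesis
      \<comment> \<open>By second countability the Borel sets of the product form the product
        sigma-algebra, so measurability can be checked by components.\<close>
      unfolding borel_prod[symmetric]
      by (intro measurable_pair)
         (auto simp: o_def intro: measurable_compose[OF measurable_fst] measurable_compose[OF measurable_snd])
  qed
  ultimately have "(\<lambda>z. indicator (S \<times> S) z *\<^sub>R case_prod h z) \<in> borel_measurable (borel_on S \<Otimes>\<^sub>M borel_on S)"
    by (rule measurable_compose[rotated])
  then show ?thesis
    by (rule measurable_cong[THEN iffD1, rotated])
       (auto simp: space_pair_measure space_restrict_space)
qed

theorem proposition6:
  fixes \<X> :: "(real ^ 'd) set"
    and h :: "real ^ 'd \<Rightarrow> real ^ 'd \<Rightarrow> real"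
    and M :: "'w measure"
    and X :: "nat \<Rightarrow> 'w \<Rightarrow> real ^ 'd"
    and P :: "(real ^ 'd) measure"
  assumes "compact \<X>"
    and h_nonneg: "\<And>x y. x \<in> \<X> \<Longrightarrow> y \<in> \<X> \<Longrightarrow> 0 \<le> h x y"
    and h_continuous: "continuous_on (\<X> \<times> \<X>) (\<lambda>(x, y). h x y)"
    and h_symmetric: "\<And>x y. x \<in> \<X> \<Longrightarrow> y \<in> \<X> \<Longrightarrow> h x y = h y x"
    and h_posdef: "positive_definite_kernel \<X> h"
    and "prob_space M"
    and "P \<in> prob_measures \<X>"
    and X_indep: "prob_space.indep_vars M (\<lambda>_. borel_on \<X>) X {1..}"
    and X_distr: "\<And>t. t \<ge> 1 \<Longrightarrow> distr M (borel_on \<X>) (X t) = P"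
  shows "convex_functional \<X> (\<lambda>\<mu>. sqrt (Phi h \<mu>)) \<and>
    (\<forall>t\<ge>1. \<forall>\<omega>\<in>space M.
       V_stat \<X> h X t \<omega> = (1 / (real t)\<^sup>2) * (\<Sum>i=1..t. \<Sum>j=1..t. h (X i \<omega>) (X j \<omega>))) \<and>
    reverse_submartingale M (exchangeable_filtration M \<X> X) (\<lambda>t \<omega>. sqrt (V_stat \<X> h X t \<omega>)) \<and>
    reverse_submartingale M (exchangeable_filtration M \<X> X) (V_stat \<X> h X)"
proof -
  interpret M: prob_space M by fact
  let ?Q = "Pi\<^sub>M {1..} (\<lambda>_::nat. borel_on \<X>)"
  have sp: "space (borel_on \<X>) = \<X>" by (simp add: space_restrict_space)
  have meas: "case_prod h \<in> borel_measurable (borel_on \<X> \<Otimes>\<^sub>M borel_on \<X>)"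
    using compact_imp_closed[OF \<open>compact \<X>\<close>] h_continuous by (rule measurable_borel_on_pair)
  \<comment> \<open>Compactness and continuity enter the energy argument through this bound and the
    measurability in \<open>meas\<close>.\<close>
  have "bounded ((\<lambda>(x, y). h x y) ` (\<X> \<times> \<X>))"
    by (intro compact_imp_bounded compact_continuous_image h_continuous compact_Times \<open>compact \<X>\<close>)
  then obtain C where C: "\<And>x y. x \<in> \<X> \<Longrightarrow> y \<in> \<X> \<Longrightarrow> \<bar>h x y\<bar> \<le> C"
    by (auto simp: bounded_iff)
  interpret K: bounded_pd_kernel "borel_on \<X>" h C
  proof
    show "h x y \<le> C" if "x \<in> space (borel_on \<X>)" "y \<in> space (borel_on \<X>)" for x y
      using C[of x y] that by (simp add: sp)
  qed (use meas h_nonneg h_symmetric h_posdef in \<open>simp_all add: sp\<close>)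
  have X_in: "X i \<omega> \<in> \<X>" if "i \<in> {1..t}" "\<omega> \<in> space M" for i t \<omega>
  proof -
    have "X i \<in> measurable M (borel_on \<X>)"
      using X_indep that(1) by (auto simp: M.indep_vars_def)
    then show ?thesis using measurable_space that(2) sp by metis
  qed
  have V: "V_stat \<X> h X t \<omega> = kernel_mean h {1..t} (\<lambda>i. X i \<omega>)" if "1 \<le> t" "\<omega> \<in> space M" for t \<omega>
    using that X_in by (intro V_stat_eq_kernel_mean meas) auto
  \<comment> \<open>\<open>kernel_mean\<close> reads only the indices in \<open>{1..t}\<close>, so
    restricting to \<open>{1..}\<close>, which makes the sequence a point of the product space, does
    not alter it.\<close>
  have V': "V_stat \<X> h X t \<omega> = kernel_mean h {1..t} (\<lambda>i\<in>{1..}. X i \<omega>)" if "1 \<le> t" "\<omega> \<in> space M" for t \<omega>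
    unfolding V[OF that] by (simp add: kernel_mean_def)
  have x_in: "x i \<in> space (borel_on \<X>)" if "x \<in> space ?Q" "i \<in> I" "I \<subseteq> {1..}" for x i I
    using that by (auto simp: space_PiM)
  have km_meas: "kernel_mean h I \<in> borel_measurable ?Q" if "I \<subseteq> {1..}" for I
    unfolding kernel_mean_def[abs_def] using that
    by (intro borel_measurable_divide borel_measurable_sum K.measurable_kernel_compose
        measurable_component_singleton borel_measurable_const) auto
  have km_permute: "kernel_mean h I (\<lambda>i. x (p i)) = kernel_mean h (p ` I) x"
    if "p permutes {1..t}" for I p x and t :: nat
    by (rule kernel_mean_reindex[OF permutes_inj_on[OF that]])
  note submartingale = reverse_submartingale_leave_one_out[OF M.prob_space_axioms X_indep X_distr]
  have "convex_functional \<X> (\<lambda>\<mu>. sqrt (Phi h \<mu>))"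
    unfolding convex_functional_def
    by (auto simp: space_prob_algebra intro!: K.sqrt_Phi_mixture_le)
  moreover have "V_stat \<X> h X t \<omega> = (1 / (real t)\<^sup>2) * (\<Sum>i=1..t. \<Sum>j=1..t. h (X i \<omega>) (X j \<omega>))"
    if "t \<ge> 1" "\<omega> \<in> space M" for t \<omega>
    unfolding V[OF that] by (simp add: kernel_mean_def)
  moreover have "reverse_submartingale M (exchangeable_filtration M \<X> X) (\<lambda>t \<omega>. sqrt (V_stat \<X> h X t \<omega>))"
  proof (rule submartingale[where g="\<lambda>I x. sqrt (kernel_mean h I x)" and C="sqrt \<bar>C\<bar>"])
    show "(\<lambda>x. sqrt (kernel_mean h I x)) \<in> borel_measurable ?Q" if "I \<subseteq> {1..}" for I
      using km_meas[OF that] by measurable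
    show "\<bar>sqrt (kernel_mean h I x)\<bar> \<le> sqrt \<bar>C\<bar>"
      if "finite I" "I \<subseteq> {1..}" "x \<in> space ?Q" for I x
      using that K.kernel_mean_bounds[of I x] x_in[OF that(3) _ that(2)] by simp
    \<comment> \<open>The index set has \<open>t + 1\<close> elements, hence at least 2, as the
      leave-one-out inequality requires.\<close>
    show "sqrt (kernel_mean h {1..t + 1} x) \<le>
        (\<Sum>k\<in>{1..t + 1}. sqrt (kernel_mean h ({1..t + 1} - {k}) x)) / real (t + 1)"
      if "1 \<le> t" "x \<in> space ?Q" for t x
      using K.sqrt_kernel_mean_le_leave_one_out[of "{1..t + 1}" x] that x_in[OF that(2), of _ "{1..t + 1}"]
      by simp
  qed (simp_all only: km_permute V')
  moreover have "reverse_submartingale M (exchangeable_filtration M \<X> X) (V_stat \<X> h X)"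
  proof (rule submartingale[where g="kernel_mean h" and C="\<bar>C\<bar>"])
    show "\<bar>kernel_mean h I x\<bar> \<le> \<bar>C\<bar>"
      if "finite I" "I \<subseteq> {1..}" "x \<in> space ?Q" for I x
      using that K.kernel_mean_bounds[of I x] x_in[OF that(3) _ that(2)] by simp
    show "kernel_mean h {1..t + 1} x \<le>
        (\<Sum>k\<in>{1..t + 1}. kernel_mean h ({1..t + 1} - {k}) x) / real (t + 1)"
      if "1 \<le> t" "x \<in> space ?Q" for t x
      using K.kernel_mean_le_leave_one_out[of "{1..t + 1}" x] that x_in[OF that(2), of _ "{1..t + 1}"]
      by simp
  qed (simp_all only: km_meas km_permute V')
  ultimately show ?thesis by blast
qed

end
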